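(* Consider the Online Gradient Control iteration described in the context, with step size $\alpha$, feasible sets $\mathcal{U}_n\subseteq\mathcal{S}_n$, objective functions $F_n$, measurements $\hat y_n$, and implemented setpoints $y_n$. Suppose that: (1) the measurement of the implemented setpoint is $\varepsilon$-accurate: $\|y_n-\hat y_n\|\le\varepsilon$ for all $n$; (2) the gradients $\{\nabla F_n\}$ are uniformly bounded and Lipschitz continuous with a common parameter $\lambda<\infty$, namely, for all $n$ and all $x,x'\in\mathcal{U}_n$, $\|\nabla F_n(x)-\nabla F_n(x')\|\le\lambda\|x-x'\|$; and $F$ denotes a finite constant that is a uniform upper bound on $\|\nabla F_n(x)\|$; (3) the sequence of feasible sets $\{\mathcal{S}_n\}$ is uniformly bounded: there is a finite constant $B$ such that $|\mathcal{S}_n|\le B$ for all $n$, where $|\mathcal{S}_n|:=\sup_{s\in\mathcal{S}_n}\|s\|$; and $D$ denotes an upper bound on the diameters, so that $\operatorname{diam}(\mathcal{S}_n)\le D$ for all $n$. Then for every infinite admissible sequence $\mathbf{z}_{1:\infty}=\{z_k\}_{k\ge1}$, i.e. with $z_k\in\mathcal{U}_k$ for all $k\ge1$, and every $\alpha>0$, $$\limsup_{n\to\infty}\frac{r_n(\mathbf{z}_{1:n})}{n}\;\le\;K_1\alpha+\frac{K_2(1+\alpha\lambda)}{\alpha}\,\varepsilon+\frac{K_3}{\alpha}\limsup_{n\to\infty}\frac{V(\mathbf{z}_{1:n})}{n},$$ where $$r_n(\mathbf{z}_{1:n})=\sum_{k=1}^n\big(F_k(y_k)-F_k(z_k)\big),\qquad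 V(\mathbf{z}_{1:n})=\sum_{k=1}^n\|z_k-z_{k+1}\|,$$ $$K_1=\frac{F^2}{2},\qquad K_2=\frac{2(D+\alpha F)+(1+\alpha\lambda)\varepsilon}{2},\qquad K_3=D+B.$$ In particular, the bound is valid for the optimal sequence $$\mathbf{z}^*_{1:n}\in\operatorname*{arg\,min}_{\mathbf{z}_{1:n}\in\mathcal{X}_n}\sum_{k=1}^nF_k(z_k),$$ where $\mathcal{X}_n$ is the set of all sequences $\{z_k\}_{k=1}^n$ with $z_k\in\mathcal{U}_k$ for $k=1,\dots,n$.
   Context: There are $J$ local controllers, indexed by $j=1,\dots,J$, and a central controller, in discrete time $n=1,2,\dots$. A setpoint vector $x$ has blocks $x(1),\dots,x(J)$ in Euclidean spaces; $\|\cdot\|$ is the Euclidean norm and $\mathcal{P}_{\mathcal{K}}(\cdot)$ denotes Euclidean projection onto a set $\mathcal{K}$. For each $n$ and $j$, $\mathcal{S}_n(j)$ is the convex compact set of feasible setpoints of local controller $j$ at time $n$, and $\mathcal{S}_n:=\mathcal{S}_n(1)\times\cdots\times\mathcal{S}_n(J)$. The function $C_n^{(j)}:\mathcal{S}_n(j)\to\mathbb{R}$ is the convex cost function of local controller $j$. For each $n$, $\mathcal{U}_n\subseteq\mathcal{S}_n$ is a compact convex set representing the system feasibility constraints. The overall objective function at time $n$ is $$F_n(x)=\sum_{j=1}^Jw_j\,C_n^{(j)}(x(j))+G_n(x),\qquad x\in\mathcal{U}_n,$$ where the $w_j$ are weighting (normalization) factors and the convex function $G_n$ represents a system-wide objective.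 (The algorithm and the regret below also evaluate $\nabla F_n$ at $\hat y_n$ and $F_n$ at $y_n$.) The sequences of sets and functions may vary arbitrarily with $n$. Online Gradient Control (OGC) with step-size parameter $\alpha$: at each time step $n$, - upon receiving a setpoint $x_n(j)$ from the central controller, local controller $j$ implements $y_n(j)=\mathcal{P}_{\mathcal{S}_n(j)}(x_n(j))$; put $y_n=(y_n(1),\dots,y_n(J))$; - an estimate (measurement) $\hat y_n$ of the implemented setpoint $y_n$ is obtained; - the central controller computes $x_{n+1}=\mathcal{P}_{\mathcal{U}_n}\big(\hat y_n-\alpha\nabla F_n(\hat y_n)\big)$ and sends $x_{n+1}(j)$ to each local controller $j$. The quantity $r_n(\mathbf{z}_{1:n})$ is the total dynamic regret of the algorithm with respect to the sequence $\mathbf{z}_{1:n}$, and $V(\mathbf{z}_{1:n})$ is the temporal variability of that sequence.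
   Formalization: The weights w_j are assumed nonnegative (with negative weights F_n need not be convex and the bound can fail), and F is taken to bound the gradients on the whole convex product domain of F_n, which contains S_n and the measurements ŷ_n. *)

theory Defs
  imports "HOL-Analysis.Analysis"
begin

text \<open>
  A setpoint is a vector of \<^typ>\<open>real^'n\<close> whose coordinates are distributed over the local
  controllers by a map \<open>b :: 'n \<Rightarrow> 'j\<close>, so that the blocks may have different dimensions.
  The Euclidean space of block \<open>j\<close> is identified with the coordinate subspace of the vectors
  that vanish at every coordinate not belonging to \<open>j\<close>.
\<close>

definition block :: "('n \<Rightarrow> 'j) \<Rightarrow> 'j \<Rightarrow> real^'n \<Rightarrow> real^'n" where
  "block b j x = (\<chi> i. if b i = j then x $ i else 0)"

definition block_space :: "('n \<Rightarrow> 'j) \<Rightarrow> 'j \<Rightarrow> (real^'n) set" where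
  "block_space b j = {v. \<forall>i. b i \<noteq> j \<longrightarrow> v $ i = 0}"

definition block_prod :: "('n \<Rightarrow> 'j) \<Rightarrow> ('j \<Rightarrow> (real^'n) set) \<Rightarrow> (real^'n) set" where
  "block_prod b A = {x. \<forall>j. block b j x \<in> A j}"

definition objective ::
  "('n \<Rightarrow> 'j::finite) \<Rightarrow> ('j \<Rightarrow> real) \<Rightarrow> ('j \<Rightarrow> real^'n \<Rightarrow> real) \<Rightarrow> (real^'n \<Rightarrow> real) \<Rightarrow> real^'n \<Rightarrow> real"
  where "objective b w C G x = (\<Sum>j\<in>UNIV. w j * C j (block b j x)) + G x"

text \<open>
  The gradient is taken relative to the domain \<open>X\<close> of \<open>f\<close>, so that it makes sense at boundary
  points of a closed domain.  It is the ordinary gradient at interior points.  Where the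
  derivative within \<open>X\<close> is not unique, any choice is admitted.
\<close>

definition gradient_on ::
  "('a::real_inner) set \<Rightarrow> ('a \<Rightarrow> real) \<Rightarrow> ('a \<Rightarrow> 'a) \<Rightarrow> bool" where
  "gradient_on X f g \<longleftrightarrow> (\<forall>x\<in>X. (f has_derivative (\<lambda>h. inner h (g x))) (at x within X))"

definition regret ::
  "(nat \<Rightarrow> 'a \<Rightarrow> real) \<Rightarrow> (nat \<Rightarrow> 'a) \<Rightarrow> (nat \<Rightarrow> 'a) \<Rightarrow> nat \<Rightarrow> real" where
  "regret f y z n = (\<Sum>k=1..n. f k (y k) - f k (z k))"

definition variability :: "(nat \<Rightarrow> 'a::real_normed_vector) \<Rightarrow> nat \<Rightarrow> real" where
  "variability z n = (\<Sum>k=1..n. norm (z k - z (Suc k)))"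

definition admissible :: "(nat \<Rightarrow> 'a set) \<Rightarrow> nat \<Rightarrow> (nat \<Rightarrow> 'a) set" where
  "admissible U n = (\<Pi>\<^sub>E k\<in>{1..n}. U k)"

definition optimal_prefix ::
  "(nat \<Rightarrow> 'a \<Rightarrow> real) \<Rightarrow> (nat \<Rightarrow> 'a set) \<Rightarrow> nat \<Rightarrow> (nat \<Rightarrow> 'a) \<Rightarrow> bool" where
  "optimal_prefix f U n z \<longleftrightarrow>
     is_arg_min (\<lambda>v. \<Sum>k=1..n. f k (v k)) (\<lambda>v. v \<in> admissible U n) (restrict z {1..n})"

end

theory Submission
  imports Defs
begin

text \<open>
  Write \<open>a\<^sub>k = \<parallel>y\<^sub>k - z\<^sub>k\<parallel>\<^sup>2\<close>.  Convexity at \<open>y\<^sub>k\<close> and at the measured point \<open>yhat\<^sub>k\<close> bounds the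
  instantaneous regret by \<open>F \<epsilon> + \<langle>\<nabla>F\<^sub>k(yhat\<^sub>k), yhat\<^sub>k - z\<^sub>k\<rangle>\<close>; expanding the square in
  \<open>\<parallel>x\<^sub>k\<^sub>+\<^sub>1 - z\<^sub>k\<parallel>\<^sup>2 \<le> \<parallel>yhat\<^sub>k - \<alpha> \<nabla>F\<^sub>k(yhat\<^sub>k) - z\<^sub>k\<parallel>\<^sup>2\<close> bounds the inner product.  Replacing \<open>z\<^sub>k\<close> by
  \<open>z\<^sub>k\<^sub>+\<^sub>1\<close> costs at most \<open>(D + 2 B) \<parallel>z\<^sub>k - z\<^sub>k\<^sub>+\<^sub>1\<parallel>\<close>, and the blockwise projection onto \<open>S\<^sub>k\<^sub>+\<^sub>1\<close> does not
  increase the distance to \<open>z\<^sub>k\<^sub>+\<^sub>1\<close>, so the differences \<open>a\<^sub>k - a\<^sub>k\<^sub>+\<^sub>1\<close> telescope.  Using the gradient at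
  \<open>yhat\<^sub>k\<close> instead of comparing it with the one at \<open>y\<^sub>k\<close> matters: neither point need lie in
  \<open>U\<^sub>k\<close>, the only place where the gradient is Lipschitz.
\<close>

section \<open>Block decomposition and blockwise projection\<close>

lemma block_diff: "block b j (u - v) = block b j u - block b j v"
  by (simp add: block_def vec_eq_iff)

lemma block_scale_add:
  "block b j (s *\<^sub>R u + t *\<^sub>R v) = s *\<^sub>R block b j u + t *\<^sub>R block b j v"
  by (simp add: block_def vec_eq_iff)

text \<open>Each coordinate belongs to exactly one block, so after swapping the two sums every
  squared coordinate is counted once.\<close>

lemma sum_norm_block_power2:
  fixes b :: "'n::finite \<Rightarrow> 'j::finite"
  shows "(\<Sum>j\<in>UNIV. (norm (block b j v))\<^sup>2) = (norm v)\<^sup>2"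
proof -
  have "(\<Sum>j\<in>UNIV. (norm (block b j v))\<^sup>2)
      = (\<Sum>j\<in>UNIV. \<Sum>i\<in>UNIV. if b i = j then (v $ i)\<^sup>2 else 0)"
    unfolding power2_norm_eq_inner inner_vec_def
    by (intro sum.cong refl) (simp add: block_def power2_eq_square)
  also have "\<dots> = (\<Sum>i\<in>UNIV. \<Sum>j\<in>UNIV. if b i = j then (v $ i)\<^sup>2 else 0)"
    by (rule sum.swap)
  also have "\<dots> = (norm v)\<^sup>2"
    unfolding power2_norm_eq_inner inner_vec_def by (simp add: power2_eq_square)
  finally show ?thesis .
qed

lemma norm_le_blockwise:
  fixes b :: "'n::finite \<Rightarrow> 'j::finite"
  assumes "\<And>j. norm (block b j u) \<le> norm (block b j v)"
  shows "norm u \<le> norm v"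
proof -
  have "(\<Sum>j\<in>UNIV. (norm (block b j u))\<^sup>2) \<le> (\<Sum>j\<in>UNIV. (norm (block b j v))\<^sup>2)"
    by (intro sum_mono power_mono assms) auto
  then show ?thesis
    by (simp add: sum_norm_block_power2 power2_le_iff_abs_le)
qed

text \<open>Projection onto \<open>A j\<close> is nonexpansive and fixes the block of
  \<open>z\<close>, so no block of the error grows; the squared norm is the sum over the
  blocks.\<close>

lemma norm_blockwise_projection_le:
  fixes b :: "'n::finite \<Rightarrow> 'j::finite"
  assumes "\<And>j. convex (A j) \<and> closed (A j)" and z: "z \<in> block_prod b A"
    and y: "\<And>j. block b j y = closest_point (A j) (block b j x)"
  shows "norm (y - z) \<le> norm (x - z)"
proof (rule norm_le_blockwise[of b])
  fix j
  have zj: "block b j z \<in> A j"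
    using z by (simp add: block_prod_def)
  then have "dist (closest_point (A j) (block b j x)) (closest_point (A j) (block b j z))
      \<le> dist (block b j x) (block b j z)"
    using assms(1)[of j] by (intro closest_point_lipschitz) auto
  then show "norm (block b j (y - z)) \<le> norm (block b j (x - z))"
    by (simp add: block_diff y closest_point_self[OF zj] dist_norm)
qed

lemma block_prod_mono: "(\<And>j. A j \<subseteq> A' j) \<Longrightarrow> block_prod b A \<subseteq> block_prod b A'"
  by (auto simp: block_prod_def)

lemma convex_block_prod: "(\<And>j. convex (A j)) \<Longrightarrow> convex (block_prod b A)"
  unfolding convex_def block_prod_def by (auto simp: block_scale_add)

lemma bounded_block_prod:
  fixes b :: "'n::finite \<Rightarrow> 'j::finite"
  assumes "\<And>j. bounded (A j)"
  shows "bounded (block_prod b A)"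
proof -
  obtain M where M: "\<And>j v. v \<in> A j \<Longrightarrow> norm v \<le> M j"
    using assms unfolding bounded_iff by metis
  have "norm v \<le> sqrt (\<Sum>j\<in>UNIV. (M j)\<^sup>2)" if "v \<in> block_prod b A" for v
  proof (rule real_le_rsqrt)
    have "(norm v)\<^sup>2 = (\<Sum>j\<in>UNIV. (norm (block b j v))\<^sup>2)"
      by (simp add: sum_norm_block_power2)
    also have "\<dots> \<le> (\<Sum>j\<in>UNIV. (M j)\<^sup>2)"
      using that by (intro sum_mono power_mono M) (auto simp: block_prod_def)
    finally show "(norm v)\<^sup>2 \<le> (\<Sum>j\<in>UNIV. (M j)\<^sup>2)" .
  qed
  then show ?thesis
    by (auto simp: bounded_iff)
qed

section \<open>Convexity of the objective and the gradient inequality\<close>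

lemma convex_on_objective:
  fixes b :: "'n::finite \<Rightarrow> 'j::finite"
  assumes w: "\<And>j. w j \<ge> 0" and C: "\<And>j. convex_on (X j) (C j)"
    and G: "convex_on (block_prod b X) G"
  shows "convex_on (block_prod b X) (objective b w C G)"
proof -
  have conv: "convex (block_prod b X)"
    by (intro convex_block_prod convex_on_imp_convex[OF C])
  have "convex_on (block_prod b X) (\<lambda>v. w j * C j (block b j v))" for j
  proof (intro convex_on_cmul w convex_onI conv)
    fix t :: real and u v
    assume t: "0 < t" "t < 1" and uv: "u \<in> block_prod b X" "v \<in> block_prod b X"
    show "C j (block b j ((1 - t) *\<^sub>R u + t *\<^sub>R v))
        \<le> (1 - t) * C j (block b j u) + t * C j (block b j v)"
      unfolding block_scale_add
      using convex_onD[OF C, of t "block b j u" j "block b j v"] t uv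
      by (simp add: block_prod_def)
  qed
  then have "convex_on (block_prod b X) (\<lambda>v. \<Sum>j\<in>J. w j * C j (block b j v))" for J
    using conv by (induction J rule: infinite_finite_induct) (auto simp: convex_on_const)
  then show ?thesis
    unfolding objective_def using G by (rule convex_on_add)
qed

text \<open>The derivative is only one within \<open>X\<close>, so the argument stays on the segment
  from \<open>u\<close> to \<open>v\<close>. If the inequality failed, \<open>f\<close> minus the
  linear growth of its chord would have a positive right derivative at \<open>u\<close>, and
  \<open>f\<close> would rise above the chord just past \<open>u\<close>, against convexity.\<close>

lemma convex_gradient_on_ineq:
  assumes f: "convex_on X f" and g: "gradient_on X f g" and u: "u \<in> X" and v: "v \<in> X"
  shows "f u - f v \<le> inner (u - v) (g u)"
proof (rule ccontr)
  let ?p = "\<lambda>t. u + t *\<^sub>R (v - u)"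
  let ?h = "\<lambda>t::real. f (?p t) - t * (f v - f u)"
  assume "\<not> ?thesis"
  then have pos: "inner (v - u) (g u) - (f v - f u) > 0"
    by (simp add: inner_diff_left)
  have p: "?p t = (1 - t) *\<^sub>R u + t *\<^sub>R v" for t
    by (simp add: algebra_simps)
  have seg: "?p t \<in> X" if "t \<in> {0..1}" for t
    unfolding p using convex_on_imp_convex[OF f] u v that by (auto intro: convexD_alt)
  have "(f has_derivative (\<lambda>k. inner k (g u))) (at (?p 0) within ?p ` {0..1})"
    using g u seg by (auto simp: gradient_on_def intro: has_derivative_subset)
  moreover have "(?p has_derivative (\<lambda>t. t *\<^sub>R (v - u))) (at 0 within {0..1})"
    by (auto intro!: derivative_eq_intros)
  ultimately have "((\<lambda>t. f (?p t)) has_derivative (\<lambda>t. inner (t *\<^sub>R (v - u)) (g u)))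
      (at 0 within {0..1})"
    by (rule has_derivative_in_compose[rotated])
  then have "(?h has_derivative (\<lambda>t. inner (t *\<^sub>R (v - u)) (g u) - t * (f v - f u)))
      (at 0 within {0..1})"
    by (auto intro!: derivative_eq_intros)
  then have "(?h has_real_derivative (inner (v - u) (g u) - (f v - f u))) (at 0 within {0..1})"
    unfolding has_field_derivative_def
    by (rule has_derivative_eq_rhs) (simp add: fun_eq_iff algebra_simps)
  from has_real_derivative_pos_inc_right[OF this pos]
  obtain d where d: "d > 0" "\<And>t. t > 0 \<Longrightarrow> 0 + t \<in> {0..1} \<Longrightarrow> t < d \<Longrightarrow> ?h 0 < ?h (0 + t)"
    by blast
  \<comment> \<open>This choice keeps \<open>t\<close> both below \<open>d\<close> and inside
    \<open>{0..1}\<close>, where the segment lies in \<open>X\<close>.\<close>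
  define t where "t = min (d / 2) 1"
  have t: "0 < t" "t \<le> 1" "t < d"
    using d(1) by (auto simp: t_def)
  have "f (?p t) \<le> (1 - t) * f u + t * f v"
    unfolding p using convex_onD[OF f, of t u v] t u v by simp
  moreover have "f u < ?h t"
    using d(2)[of t] t by simp
  ultimately show False
    by (simp add: algebra_simps)
qed

section \<open>Inequalities for a single step, and averaging\<close>

lemma norm_power2_change_comparator:
  fixes x :: "'a::real_inner"
  shows "(norm (x - z'))\<^sup>2 - (norm (x - z))\<^sup>2 \<le> (norm (x - z) + norm (x - z')) * norm (z - z')"
proof -
  have "norm (x - z') - norm (x - z) \<le> norm (z - z')"
    using norm_triangle_ineq2[of "x - z'" "x - z"] by simp
  then have "(norm (x - z) + norm (x - z')) * (norm (x - z') - norm (x - z))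
      \<le> (norm (x - z) + norm (x - z')) * norm (z - z')"
    by (intro mult_left_mono) auto
  then show ?thesis
    by (simp add: power2_eq_square algebra_simps)
qed

text \<open>Expanding the square isolates the inner product. The distance from \<open>yhat\<close>
  to \<open>z\<close> is then traded for that from \<open>y\<close>, since \<open>D\<close> controls
  only the implemented point; this costs
  \<open>2 * D * \<epsilon> + \<epsilon>\<^sup>2\<close>.\<close>

lemma inexact_gradient_step:
  fixes g y yhat z x' :: "'a::real_inner"
  assumes "norm (x' - z) \<le> norm (yhat - \<alpha> *\<^sub>R g - z)" and "norm g \<le> F"
    and "norm (y - yhat) \<le> \<epsilon>" and "norm (y - z) \<le> D"
  shows "2 * \<alpha> * inner (yhat - z) g
      \<le> (norm (y - z))\<^sup>2 - (norm (x' - z))\<^sup>2 + \<alpha>\<^sup>2 * F\<^sup>2 + 2 * D * \<epsilon> + \<epsilon>\<^sup>2"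
proof -
  have \<epsilon>: "\<epsilon> \<ge> 0"
    using norm_ge_zero assms(3) by (rule order_trans)
  have "(norm (x' - z))\<^sup>2 \<le> (norm ((yhat - z) - \<alpha> *\<^sub>R g))\<^sup>2"
    using assms(1) by (intro power_mono) (auto simp: algebra_simps)
  also have "\<dots> = (norm (yhat - z))\<^sup>2 - 2 * \<alpha> * inner (yhat - z) g + \<alpha>\<^sup>2 * (norm g)\<^sup>2"
    unfolding power2_norm_eq_inner
    by (simp add: inner_diff_left inner_diff_right inner_commute power2_eq_square algebra_simps)
  also have "\<alpha>\<^sup>2 * (norm g)\<^sup>2 \<le> \<alpha>\<^sup>2 * F\<^sup>2"
    using assms(2) by (intro mult_left_mono power_mono) auto
  finally have 1: "(norm (x' - z))\<^sup>2
      \<le> (norm (yhat - z))\<^sup>2 - 2 * \<alpha> * inner (yhat - z) g + \<alpha>\<^sup>2 * F\<^sup>2"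
    by simp
  have "norm (yhat - z) \<le> norm (y - z) + \<epsilon>"
    using norm_triangle_ineq4[of "y - z" "y - yhat"] assms(3) by simp
  then have "(norm (yhat - z))\<^sup>2 \<le> (norm (y - z) + \<epsilon>)\<^sup>2"
    by (intro power_mono) auto
  also have "\<dots> = (norm (y - z))\<^sup>2 + 2 * norm (y - z) * \<epsilon> + \<epsilon>\<^sup>2"
    by (simp add: power2_sum)
  also have "2 * norm (y - z) * \<epsilon> \<le> 2 * D * \<epsilon>"
    using assms(4) \<epsilon> by (intro mult_right_mono) auto
  finally show ?thesis
    using 1 by simp
qed

text \<open>Division by \<open>n\<close> makes the contribution of \<open>c0\<close> vanish in the
  limit, and \<open>k \<ge> 0\<close> allows \<open>k\<close> to leave the limsup.\<close>

lemma limsup_average_le: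
  fixes r v :: "nat \<Rightarrow> real"
  assumes le: "\<And>n. r n \<le> c0 + real n * c + k * v n" and "k \<ge> 0"
  shows "limsup (\<lambda>n. ereal (r n / real n))
      \<le> ereal c + ereal k * limsup (\<lambda>n. ereal (v n / real n))"
proof -
  have "eventually (\<lambda>n. ereal (r n / real n)
      \<le> ereal (c0 / real n + c) + ereal k * ereal (v n / real n)) sequentially"
    using eventually_gt_at_top[of 0]
  proof eventually_elim
    case (elim n)
    have "r n / real n \<le> (c0 + real n * c + k * v n) / real n"
      by (intro divide_right_mono le) auto
    also have "\<dots> = c0 / real n + c + k * (v n / real n)"
      using elim by (simp add: field_simps)
    finally show ?case by simp
  qed
  then have "limsup (\<lambda>n. ereal (r n / real n))
      \<le> limsup (\<lambda>n. ereal (c0 / real n + c) + ereal k * ereal (v n / real n))"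
    by (rule Limsup_mono)
  also have "\<dots> \<le> limsup (\<lambda>n. ereal (c0 / real n + c))
      + limsup (\<lambda>n. ereal k * ereal (v n / real n))"
    by (rule ereal_limsup_add_mono)
  also have "limsup (\<lambda>n. ereal (c0 / real n + c)) = ereal c"
  proof (rule lim_imp_Limsup)
    have "(\<lambda>n. c0 / real n + c) \<longlonglongrightarrow> 0 + c"
      by (intro tendsto_add lim_const_over_n tendsto_const)
    then show "(\<lambda>n. ereal (c0 / real n + c)) \<longlonglongrightarrow> ereal c"
      by simp
  qed simp
  also have "limsup (\<lambda>n. ereal k * ereal (v n / real n))
      = ereal k * limsup (\<lambda>n. ereal (v n / real n))"
    using \<open>k \<ge> 0\<close> by (intro Limsup_ereal_mult_left) auto
  finally show ?thesis .
qed

section \<open>The regret bound for Online Gradient Control\<close>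

theorem theorem1:
  fixes b :: "'n::finite \<Rightarrow> 'j::finite"
    and w :: "'j \<Rightarrow> real"
    and S X :: "nat \<Rightarrow> 'j \<Rightarrow> (real^'n) set"
    and U :: "nat \<Rightarrow> (real^'n) set"
    and C :: "nat \<Rightarrow> 'j \<Rightarrow> real^'n \<Rightarrow> real"
    and G Fn :: "nat \<Rightarrow> real^'n \<Rightarrow> real"
    and gradF :: "nat \<Rightarrow> real^'n \<Rightarrow> real^'n"
    and x y yhat :: "nat \<Rightarrow> real^'n"
    and \<alpha> \<epsilon> lam F B D K1 K2 K3 :: real
  \<comment> \<open>feasible sets; \<open>X n j\<close> is the domain on which the cost of controller \<open>j\<close> is defined\<close>
  assumes S_set: "\<And>n j. n \<ge> 1 \<Longrightarrow> convex (S n j) \<and> compact (S n j)"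
    and S_dom: "\<And>n j. n \<ge> 1 \<Longrightarrow> S n j \<subseteq> X n j"
    and X_space: "\<And>n j. n \<ge> 1 \<Longrightarrow> X n j \<subseteq> block_space b j"
    and U_set: "\<And>n. n \<ge> 1 \<Longrightarrow> convex (U n) \<and> compact (U n) \<and> U n \<subseteq> block_prod b (S n)"
  \<comment> \<open>objective functions\<close>
    and w_nonneg: "\<And>j. w j \<ge> 0"
    and C_convex: "\<And>n j. n \<ge> 1 \<Longrightarrow> convex_on (X n j) (C n j)"
    and G_convex: "\<And>n. n \<ge> 1 \<Longrightarrow> convex_on (block_prod b (X n)) (G n)"
    and Fn_eq: "\<And>n. n \<ge> 1 \<Longrightarrow> Fn n = objective b w (C n) (G n)"
    and Fn_grad: "\<And>n. n \<ge> 1 \<Longrightarrow> gradient_on (block_prod b (X n)) (Fn n) (gradF n)"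
  \<comment> \<open>Online Gradient Control\<close>
    and alpha_pos: "\<alpha> > 0"
    and local_step: "\<And>n j. n \<ge> 1 \<Longrightarrow> block b j (y n) = closest_point (S n j) (block b j (x n))"
    and yhat_dom: "\<And>n. n \<ge> 1 \<Longrightarrow> yhat n \<in> block_prod b (X n)"
    and central_step:
      "\<And>n. n \<ge> 1 \<Longrightarrow> x (Suc n) = closest_point (U n) (yhat n - \<alpha> *\<^sub>R gradF n (yhat n))"
  \<comment> \<open>hypotheses (1)--(3)\<close>
    and measurement: "\<And>n. n \<ge> 1 \<Longrightarrow> norm (y n - yhat n) \<le> \<epsilon>"
    and grad_lipschitz: "\<And>n. n \<ge> 1 \<Longrightarrow> lam-lipschitz_on (U n) (gradF n)"
    and grad_bound: "\<And>n v. n \<ge> 1 \<Longrightarrow> v \<in> block_prod b (X n) \<Longrightarrow> norm (gradF n v) \<le> F"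
    and S_bound: "\<And>n. n \<ge> 1 \<Longrightarrow> (SUP s\<in>block_prod b (S n). norm s) \<le> B"
    and S_diam: "\<And>n. n \<ge> 1 \<Longrightarrow> diameter (block_prod b (S n)) \<le> D"
  \<comment> \<open>constants\<close>
    and K1: "K1 = F\<^sup>2 / 2"
    and K2: "K2 = (2 * (D + \<alpha> * F) + (1 + \<alpha> * lam) * \<epsilon>) / 2"
    and K3: "K3 = D + B"
  shows "(\<forall>z. (\<forall>k\<ge>1. z k \<in> U k) \<longrightarrow>
            limsup (\<lambda>n. ereal (regret Fn y z n / real n))
              \<le> ereal (K1 * \<alpha> + K2 * (1 + \<alpha> * lam) / \<alpha> * \<epsilon>)
                + ereal (K3 / \<alpha>) * limsup (\<lambda>n. ereal (variability z n / real n)))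
       \<and> (\<forall>z. (\<forall>n\<ge>1. optimal_prefix Fn U n z) \<longrightarrow>
            limsup (\<lambda>n. ereal (regret Fn y z n / real n))
              \<le> ereal (K1 * \<alpha> + K2 * (1 + \<alpha> * lam) / \<alpha> * \<epsilon>)
                + ereal (K3 / \<alpha>) * limsup (\<lambda>n. ereal (variability z n / real n)))"
proof -
  have main: "limsup (\<lambda>n. ereal (regret Fn y z n / real n))
      \<le> ereal (K1 * \<alpha> + K2 * (1 + \<alpha> * lam) / \<alpha> * \<epsilon>)
        + ereal (K3 / \<alpha>) * limsup (\<lambda>n. ereal (variability z n / real n))"
    if zU: "\<And>k. k \<ge> 1 \<Longrightarrow> z k \<in> U k" for z
  proof -
    \<comment> \<open>The signs of the constants are not assumed; they follow from the hypotheses at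
      time 1.\<close>
    have \<epsilon>: "\<epsilon> \<ge> 0"
      using norm_ge_zero measurement[of 1] by (rule order_trans) simp
    have lam: "lam \<ge> 0"
      using grad_lipschitz[of 1] by (simp add: lipschitz_on_def)
    have F: "F \<ge> 0"
      using norm_ge_zero grad_bound[OF _ yhat_dom, of 1] by (rule order_trans) simp_all
    have bdd: "bounded (block_prod b (S k))" if "k \<ge> 1" for k
      using S_set[OF that] by (intro bounded_block_prod) (simp add: compact_imp_bounded)
    have SX: "block_prod b (S k) \<subseteq> block_prod b (X k)" if "k \<ge> 1" for k
      using S_dom[OF that] by (rule block_prod_mono)
    have zS: "z k \<in> block_prod b (S k)" if "k \<ge> 1" for k
      using zU[OF that] U_set[OF that] by blast
    \<comment> \<open>\<open>closest_point\<close> lands in its set only if the set is nonempty; the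
      blocks of \<open>z k\<close> are the witnesses.\<close>
    have yS: "y k \<in> block_prod b (S k)" if "k \<ge> 1" for k
      using zS[OF that] S_set[OF that]
      by (auto simp: block_prod_def local_step[OF that] compact_imp_closed
          intro!: closest_point_in_set)
    have xU: "x (Suc k) \<in> U k" if "k \<ge> 1" for k
      unfolding central_step[OF that] using zU[OF that] U_set[OF that]
      by (intro closest_point_in_set) (auto simp: compact_imp_closed)
    have xS: "x (Suc k) \<in> block_prod b (S k)" if "k \<ge> 1" for k
      using xU[OF that] U_set[OF that] by blast
    have diam: "norm (u - v) \<le> D"
      if "k \<ge> 1" "u \<in> block_prod b (S k)" "v \<in> block_prod b (S k)" for k u v
      using diameter_bounded_bound[OF bdd[OF that(1)] that(2,3)] S_diam[OF that(1)]
      by (simp add: dist_norm)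
    have B: "norm u \<le> B" if "k \<ge> 1" "u \<in> block_prod b (S k)" for k u
    proof -
      \<comment> \<open>The supremum is taken in the reals, so it dominates the norms only once they
        are known to be bounded above.\<close>
      have "bdd_above (norm ` block_prod b (S k))"
        using bdd[OF that(1)] by (auto simp: bounded_iff bdd_above_def)
      then have "norm u \<le> (SUP s\<in>block_prod b (S k). norm s)"
        using that(2) by (rule cSUP_upper[rotated])
      also have "\<dots> \<le> B"
        using that(1) by (rule S_bound)
      finally show ?thesis .
    qed
    have D0: "D \<ge> 0"
      using norm_ge_zero diam[OF _ zS zS, of 1] by (rule order_trans) simp_all
    have B0: "B \<ge> 0"
      using norm_ge_zero B[OF _ zS, of 1] by (rule order_trans) simp_all
    \<comment> \<open>The cost per step that does not telescope: \<open>F * \<epsilon>\<close> for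
      passing from \<open>y k\<close> to \<open>yhat k\<close>, and the error terms of
      \<open>inexact_gradient_step\<close> divided by \<open>2 * \<alpha>\<close>.\<close>
    define c where "c = F * \<epsilon> + \<alpha> * F\<^sup>2 / 2 + (2 * D * \<epsilon> + \<epsilon>\<^sup>2) / (2 * \<alpha>)"
    define a where "a k = (norm (y k - z k))\<^sup>2" for k
    have step: "Fn k (y k) - Fn k (z k)
        \<le> c + (a k - a (Suc k)) / (2 * \<alpha>) + K3 / \<alpha> * norm (z k - z (Suc k))"
      if k: "k \<ge> 1" for k
    proof -
      have k': "Suc k \<ge> 1" by simp
      have conv: "convex_on (block_prod b (X k)) (Fn k)"
        unfolding Fn_eq[OF k] using k by (intro convex_on_objective w_nonneg C_convex G_convex)
      note ineq = convex_gradient_on_ineq[OF conv Fn_grad[OF k]]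
      have yX: "y k \<in> block_prod b (X k)" and zX: "z k \<in> block_prod b (X k)"
        using SX[OF k] yS[OF k] zS[OF k] by auto
      have "Fn k (y k) - Fn k (yhat k) \<le> inner (y k - yhat k) (gradF k (y k))"
        by (intro ineq yX yhat_dom k)
      also have "\<dots> \<le> norm (y k - yhat k) * norm (gradF k (y k))"
        by (rule norm_cauchy_schwarz)
      also have "\<dots> \<le> \<epsilon> * F"
        using k yX \<epsilon> by (intro mult_mono measurement grad_bound) auto
      finally have 1: "Fn k (y k) - Fn k (yhat k) \<le> F * \<epsilon>"
        by (simp add: mult.commute)
      have 2: "Fn k (yhat k) - Fn k (z k) \<le> inner (yhat k - z k) (gradF k (yhat k))"
        by (intro ineq zX yhat_dom k)
      have "dist (x (Suc k)) (closest_point (U k) (z k))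
          \<le> dist (yhat k - \<alpha> *\<^sub>R gradF k (yhat k)) (z k)"
        unfolding central_step[OF k] using zU[OF k] U_set[OF k]
        by (intro closest_point_lipschitz) (auto simp: compact_imp_closed)
      then have "norm (x (Suc k) - z k) \<le> norm (yhat k - \<alpha> *\<^sub>R gradF k (yhat k) - z k)"
        by (simp add: closest_point_self[OF zU[OF k]] dist_norm)
      then have 3: "2 * \<alpha> * inner (yhat k - z k) (gradF k (yhat k))
          \<le> a k - (norm (x (Suc k) - z k))\<^sup>2 + \<alpha>\<^sup>2 * F\<^sup>2 + 2 * D * \<epsilon> + \<epsilon>\<^sup>2"
        unfolding a_def
        by (rule inexact_gradient_step[OF _ grad_bound[OF k yhat_dom[OF k]] measurement[OF k]
              diam[OF k yS[OF k] zS[OF k]]])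
      \<comment> \<open>\<open>x (Suc k)\<close> lies in the feasible set of time \<open>k\<close>
        and \<open>z (Suc k)\<close> in that of time \<open>Suc k\<close>, so no single diameter
        bounds their distance. The two norms give \<open>2 * B\<close>, and
        \<open>D + 2 * B \<le> 2 * K3\<close>.\<close>
      have "norm (x (Suc k) - z (Suc k)) \<le> norm (x (Suc k)) + norm (z (Suc k))"
        by (rule norm_triangle_ineq4)
      also have "\<dots> \<le> B + B"
        by (intro add_mono B[OF k xS[OF k]] B[OF k' zS[OF k']])
      finally have "norm (x (Suc k) - z k) + norm (x (Suc k) - z (Suc k)) \<le> 2 * K3"
        using diam[OF k xS[OF k] zS[OF k]] D0 K3 by simp
      then have "(norm (x (Suc k) - z k) + norm (x (Suc k) - z (Suc k))) * norm (z k - z (Suc k))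
          \<le> 2 * K3 * norm (z k - z (Suc k))"
        by (rule mult_right_mono) simp
      then have 4: "(norm (x (Suc k) - z (Suc k)))\<^sup>2 - (norm (x (Suc k) - z k))\<^sup>2
          \<le> 2 * K3 * norm (z k - z (Suc k))"
        by (rule order_trans[OF norm_power2_change_comparator])
      \<comment> \<open>The comparator has been moved to \<open>z (Suc k)\<close> first because the
        projection yielding \<open>y (Suc k)\<close> is onto the sets of time \<open>Suc k\<close>,
        which contain the blocks of that point.\<close>
      have "norm (y (Suc k) - z (Suc k)) \<le> norm (x (Suc k) - z (Suc k))"
        using S_set[OF k'] zS[OF k'] local_step[OF k']
        by (intro norm_blockwise_projection_le[of "S (Suc k)" _ b]) (auto simp: compact_imp_closed)
      then have 5: "a (Suc k) \<le> (norm (x (Suc k) - z (Suc k)))\<^sup>2"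
        unfolding a_def by (intro power_mono) auto
      have "2 * \<alpha> * (Fn k (y k) - Fn k (z k))
          \<le> 2 * \<alpha> * (F * \<epsilon> + inner (yhat k - z k) (gradF k (yhat k)))"
        using 1 2 alpha_pos by (intro mult_left_mono) auto
      also have "\<dots> \<le> 2 * \<alpha> * (F * \<epsilon>) + a k - a (Suc k) + \<alpha>\<^sup>2 * F\<^sup>2 + 2 * D * \<epsilon> + \<epsilon>\<^sup>2
          + 2 * K3 * norm (z k - z (Suc k))"
        using 3 4 5 by (simp add: distrib_left)
      also have "\<dots> = 2 * \<alpha> * (c + (a k - a (Suc k)) / (2 * \<alpha>)
          + K3 / \<alpha> * norm (z k - z (Suc k)))"
        using alpha_pos by (simp add: c_def field_simps power2_eq_square)
      finally show ?thesis
        using alpha_pos by simp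
    qed
    have "regret Fn y z n
        \<le> (a 1 - a (Suc n)) / (2 * \<alpha>) + real n * c + K3 / \<alpha> * variability z n" for n
    proof (induction n)
      case 0
      then show ?case by (simp add: regret_def variability_def)
    next
      case (Suc n)
      have "regret Fn y z (Suc n) = regret Fn y z n + (Fn (Suc n) (y (Suc n)) - Fn (Suc n) (z (Suc n)))"
        by (simp add: regret_def)
      also have "\<dots> \<le> (a 1 - a (Suc n)) / (2 * \<alpha>) + real n * c + K3 / \<alpha> * variability z n
          + (c + (a (Suc n) - a (Suc (Suc n))) / (2 * \<alpha>)
             + K3 / \<alpha> * norm (z (Suc n) - z (Suc (Suc n))))"
        by (intro add_mono Suc step) simp
      also have "\<dots> = (a 1 - a (Suc (Suc n))) / (2 * \<alpha>) + real (Suc n) * c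
          + K3 / \<alpha> * variability z (Suc n)"
        by (simp add: variability_def algebra_simps diff_divide_distrib)
      finally show ?case .
    qed
    \<comment> \<open>Dropping the square \<open>a (Suc n)\<close> leaves a term independent of
      \<open>n\<close>, which serves as \<open>c0\<close> in
      \<open>limsup_average_le\<close>.\<close>
    moreover have "(a 1 - a (Suc n)) / (2 * \<alpha>) \<le> a 1 / (2 * \<alpha>)" for n
      using alpha_pos by (intro divide_right_mono) (auto simp: a_def)
    ultimately have bound:
      "regret Fn y z n \<le> a 1 / (2 * \<alpha>) + real n * c + K3 / \<alpha> * variability z n" for n
      by (smt (verit))
    have "limsup (\<lambda>n. ereal (regret Fn y z n / real n))
        \<le> ereal c + ereal (K3 / \<alpha>) * limsup (\<lambda>n. ereal (variability z n / real n))"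
      using D0 B0 alpha_pos K3 by (intro limsup_average_le[OF bound]) auto
    \<comment> \<open>\<open>c\<close> is the claimed constant evaluated at \<open>lam = 0\<close>,
      and that constant is monotone in \<open>lam \<ge> 0\<close>.\<close>
    moreover have "c \<le> K1 * \<alpha> + K2 * (1 + \<alpha> * lam) / \<alpha> * \<epsilon>"
    proof -
      have al: "\<alpha> * lam \<ge> 0"
        using alpha_pos lam by simp
      have "\<epsilon> \<le> (1 + \<alpha> * lam) * \<epsilon>"
        using al \<epsilon> by (simp add: distrib_right)
      then have K2_ge: "D + \<alpha> * F + \<epsilon> / 2 \<le> K2"
        unfolding K2 by simp
      moreover have "0 \<le> D + \<alpha> * F + \<epsilon> / 2"
        using D0 F \<epsilon> alpha_pos by simp
      ultimately have "(D + \<alpha> * F + \<epsilon> / 2) * 1 \<le> K2 * (1 + \<alpha> * lam)"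
        using al by (intro mult_mono) auto
      then have "(D + \<alpha> * F + \<epsilon> / 2) / \<alpha> * \<epsilon> \<le> K2 * (1 + \<alpha> * lam) / \<alpha> * \<epsilon>"
        using alpha_pos \<epsilon> by (intro mult_right_mono divide_right_mono) auto
      moreover have "c = K1 * \<alpha> + (D + \<alpha> * F + \<epsilon> / 2) / \<alpha> * \<epsilon>"
        using alpha_pos by (simp add: c_def K1 field_simps power2_eq_square)
      ultimately show ?thesis by simp
    qed
    ultimately show ?thesis
      by (meson add_right_mono ereal_less_eq(3) order_trans)
  qed
  \<comment> \<open>The prefix of length \<open>n = k\<close> is admissible after restriction to
    \<open>{1..k}\<close>; evaluating it at its last index \<open>k\<close> shows that
    \<open>main\<close> applies to \<open>z\<close>.\<close>
  have "z k \<in> U k" if "\<forall>n\<ge>1. optimal_prefix Fn U n z" "k \<ge> 1" for z k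
  proof -
    have "restrict z {1..k} \<in> (\<Pi>\<^sub>E i\<in>{1..k}. U i)"
      using that by (auto simp: optimal_prefix_def is_arg_min_def admissible_def)
    then have "restrict z {1..k} k \<in> U k"
      by (rule PiE_mem) (use that in simp)
    then show ?thesis
      using that by simp
  qed
  with main show ?thesis by blast
qed

end
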